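(* Let $\varepsilon>0$ be fixed and let $(H,\Psi)$ be the convex entropy–entropy flux pair of the Jin–Xin relaxation model. Under the subcharacteristic condition $\lambda>\max_{u\in K}\rho(\nabla_ug(u))$ and the CFL condition $\frac{\lambda\Delta t}{\Delta x}\le\frac12$, the approximate-Riemann-solver scheme for the Jin–Xin model (given in the context) satisfies a local discrete entropy inequality: with $\mathbf W_j^n=(u_j^n,v_j^n)$, for all $j\in\mathbb Z$, $$H(\mathbf W_j^{n+1})\le H(\mathbf W_j^n)-\frac{\Delta t}{\Delta x}\big(\Psi^{HLL}_{j+1/2}-\Psi^{HLL}_{j-1/2}\big)+\Delta t\,D_j,$$ where $\Psi^{HLL}_{j+1/2}=\Psi^{HLL}(\mathbf W_j^n,\mathbf W_{j+1}^n)$ is a numerical entropy flux consistent with $\Psi$ (that of the HLL scheme for the homogeneous Jin–Xin system), and $D_j=D_j(\Delta t,\Delta x;\mathbf W_{j-1}^n,\mathbf W_j^n,\mathbf W_{j+1}^n)$ is consistent with the entropy dissipation of the source term: $$D_j\longrightarrow\frac1\varepsilon\,\partial_vH(u,v)\cdot(g(u)-v)$$ as $\Delta t,\Delta x\to0$ (under the CFL condition) and $\mathbf W_{j-1}^n,\mathbf W_j^n,\mathbf W_{j+1}^n\to(u,v)$.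
   Context: Jin–Xin model: $\partial_tu+\partial_xv=0$, $\partial_tv+\lambda^2\partial_xu=\frac1\varepsilon(g(u)-v)$, with $\varepsilon>0$, $\lambda>0$, a relaxation of the system of conservation laws $\partial_tu+\partial_xg(u)=0$, where $g$ is $C^2$ on a convex set $K$ of admissible states and $\partial_tu+\partial_xg(u)=0$ has a convex entropy–entropy flux pair $(\eta,q)$. $\rho$ denotes spectral radius. With $K_\pm=\{u\pm\frac1\lambda g(u):u\in K\}$ (convex, with $K=\frac12(K_++K_-)$), set $D_K^\lambda=\{(u,v): u+\frac1\lambda v\in K_+,\ u-\frac1\lambda v\in K_-\}$. Under the subcharacteristic condition, $(\eta,q)$ extends (Serre) to an entropy–entropy flux pair $(H,\Psi):D_K^\lambda\to\mathbb R^2$ of the Jin–Xin system, with $H$ smooth and convex, coinciding with $(\eta,q)$ on $\{v=g(u)\}$, and $\partial_vH(u,v)\cdot(g(u)-v)\le0$. All states at which $H$ is evaluated are understood to lie in $D_K^\lambda$. Scheme: $$u_j^{n+1}=u_j^n-\tfrac{\Delta t}{\Delta x}\Big(-\tfrac\lambda2(u_{j+1}^n-2u_j^n+u_{j-1}^n)+\tfrac12\big((v_{j+1}^n-g(u_{j+1}^n))e^{-\Delta t/\varepsilon}+g(u_{j+1}^n)-(v_{j-1}^n-g(u_{j-1}^n))e^{-\Delta t/\varepsilon}-g(u_{j-1}^n)\big)\Big),$$ $$v_j^{n+1}=v_j^n-\tfrac{\Delta t}{\Delta x}\Big(-\tfrac{\lambda e^{-\Delta t/\varepsilon}}2(v_{j+1}^n-2v_j^n+v_{j-1}^n)-\tfrac{\lambda^2\varepsilon(e^{-\Delta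 t/\varepsilon}-1)}{2\Delta t}(u_{j+1}^n-u_{j-1}^n)\Big)-(e^{-\Delta t/\varepsilon}-1)(g(u_j^{n+1})-v_j^n).$$ HLL scheme for the homogeneous Jin–Xin system (source term suppressed, wave speeds $\pm\lambda$): $$u_j^{HLL}=u_j^n-\tfrac{\Delta t}{\Delta x}\big(-\tfrac\lambda2(u_{j+1}^n-2u_j^n+u_{j-1}^n)+\tfrac12(v_{j+1}^n-v_{j-1}^n)\big),$$ $$v_j^{HLL}=v_j^n-\tfrac{\Delta t}{\Delta x}\big(-\tfrac\lambda2(v_{j+1}^n-2v_j^n+v_{j-1}^n)+\tfrac{\lambda^2}2(u_{j+1}^n-u_{j-1}^n)\big).$$ *)

theory Defs
  imports "HOL-Analysis.Analysis"
begin

text \<open>Neither the convex set of admissible states nor the domain of the extended entropy is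
  assumed to be open, so derivatives are taken relative to the set. The derivative is an explicit
  argument because the gradients \<open>g'\<close> and \<open>H'\<close> occur in the statement.\<close>

definition C1_on ::
    "'a::real_normed_vector set \<Rightarrow> ('a \<Rightarrow> 'b::real_normed_vector) \<Rightarrow> ('a \<Rightarrow> 'a \<Rightarrow>\<^sub>L 'b) \<Rightarrow> bool"
  where "C1_on S f f' \<longleftrightarrow>
    (\<forall>x\<in>S. (f has_derivative blinfun_apply (f' x)) (at x within S)) \<and> continuous_on S f'"

definition C2_on ::
    "'a::real_normed_vector set \<Rightarrow> ('a \<Rightarrow> 'b::real_normed_vector) \<Rightarrow> ('a \<Rightarrow> 'a \<Rightarrow>\<^sub>L 'b) \<Rightarrow> bool"
  where "C2_on S f f' \<longleftrightarrow> C1_on S f f' \<and> (\<exists>f''. C1_on S f' f'')"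

text \<open>Eigenvalues of a real matrix are taken over the complex numbers.\<close>

definition spectral_radius :: "real^'n^'n \<Rightarrow> real"
  where "spectral_radius A =
    Max {cmod \<mu> | \<mu>. \<exists>x::complex^'n. x \<noteq> 0 \<and> (\<chi> i j. complex_of_real (A $ i $ j)) *v x = \<mu> *s x}"

text \<open>\<open>(E, Q)\<close> is a convex entropy with entropy flux for a system of conservation laws whose flux has
  differential \<open>F'\<close>: the compatibility relation is \<open>DQ(x) = DE(x) \<circ> F'(x)\<close>.\<close>

definition convex_entropy_pair ::
    "'a::real_normed_vector set \<Rightarrow> ('a \<Rightarrow> 'a \<Rightarrow> 'a) \<Rightarrow> ('a \<Rightarrow> real) \<Rightarrow> ('a \<Rightarrow> 'a \<Rightarrow>\<^sub>L real) \<Rightarrow> ('a \<Rightarrow> real) \<Rightarrow> bool"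
  where "convex_entropy_pair S F' E E' Q \<longleftrightarrow>
    convex_on S E \<and> C1_on S E E' \<and>
    (\<exists>Q'. C1_on S Q Q' \<and> (\<forall>x\<in>S. \<forall>h. blinfun_apply (Q' x) h = blinfun_apply (E' x) (F' x h)))"

type_synonym 'n state = "(real^'n) \<times> (real^'n)"

text \<open>The homogeneous Jin--Xin system is linear, so its flux is its own differential.\<close>

definition jx_flux :: "real \<Rightarrow> 'n::finite state \<Rightarrow> 'n state"
  where "jx_flux lam = (\<lambda>(u, v). (v, lam\<^sup>2 *\<^sub>R u))"

definition K_plus :: "real \<Rightarrow> (real^'n \<Rightarrow> real^'n) \<Rightarrow> (real^'n) set \<Rightarrow> (real^'n) set"
  where "K_plus lam g K = (\<lambda>u. u + (1 / lam) *\<^sub>R g u) ` K"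

definition K_minus :: "real \<Rightarrow> (real^'n \<Rightarrow> real^'n) \<Rightarrow> (real^'n) set \<Rightarrow> (real^'n) set"
  where "K_minus lam g K = (\<lambda>u. u - (1 / lam) *\<^sub>R g u) ` K"

definition jx_domain :: "real \<Rightarrow> (real^'n \<Rightarrow> real^'n) \<Rightarrow> (real^'n) set \<Rightarrow> 'n::finite state set"
  where "jx_domain lam g K =
    {(u, v). u + (1 / lam) *\<^sub>R v \<in> K_plus lam g K \<and> u - (1 / lam) *\<^sub>R v \<in> K_minus lam g K}"

text \<open>One time step at a cell, as a function of the states in the left, central and right cells.\<close>

definition jx_step_u ::
    "real \<Rightarrow> real \<Rightarrow> (real^'n \<Rightarrow> real^'n) \<Rightarrow> real \<Rightarrow> real \<Rightarrow>
     'n::finite state \<Rightarrow> 'n state \<Rightarrow> 'n state \<Rightarrow> real^'n"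
  where "jx_step_u lam eps g dt dx = (\<lambda>(uL, vL) (u, v) (uR, vR).
    u - (dt / dx) *\<^sub>R
      (- (lam / 2) *\<^sub>R (uR - 2 *\<^sub>R u + uL)
       + (1 / 2) *\<^sub>R (exp (- dt / eps) *\<^sub>R (vR - g uR) + g uR
                    - exp (- dt / eps) *\<^sub>R (vL - g uL) - g uL)))"

definition jx_step_v ::
    "real \<Rightarrow> real \<Rightarrow> (real^'n \<Rightarrow> real^'n) \<Rightarrow> real \<Rightarrow> real \<Rightarrow>
     'n::finite state \<Rightarrow> 'n state \<Rightarrow> 'n state \<Rightarrow> real^'n"
  where "jx_step_v lam eps g dt dx = (\<lambda>(uL, vL) (u, v) (uR, vR).
    v - (dt / dx) *\<^sub>R
      (- (lam * exp (- dt / eps) / 2) *\<^sub>R (vR - 2 *\<^sub>R v + vL)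
       - (lam\<^sup>2 * eps * (exp (- dt / eps) - 1) / (2 * dt)) *\<^sub>R (uR - uL))
      - (exp (- dt / eps) - 1) *\<^sub>R
          (g (jx_step_u lam eps g dt dx (uL, vL) (u, v) (uR, vR)) - v))"

definition jx_step ::
    "real \<Rightarrow> real \<Rightarrow> (real^'n \<Rightarrow> real^'n) \<Rightarrow> real \<Rightarrow> real \<Rightarrow>
     'n::finite state \<Rightarrow> 'n state \<Rightarrow> 'n state \<Rightarrow> 'n state"
  where "jx_step lam eps g dt dx WL W WR =
    (jx_step_u lam eps g dt dx WL W WR, jx_step_v lam eps g dt dx WL W WR)"

definition hll_step ::
    "real \<Rightarrow> real \<Rightarrow> real \<Rightarrow> 'n::finite state \<Rightarrow> 'n state \<Rightarrow> 'n state \<Rightarrow> 'n state"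
  where "hll_step lam dt dx = (\<lambda>(uL, vL) (u, v) (uR, vR).
    (u - (dt / dx) *\<^sub>R (- (lam / 2) *\<^sub>R (uR - 2 *\<^sub>R u + uL) + (1 / 2) *\<^sub>R (vR - vL)),
     v - (dt / dx) *\<^sub>R (- (lam / 2) *\<^sub>R (vR - 2 *\<^sub>R v + vL) + (lam\<^sup>2 / 2) *\<^sub>R (uR - uL))))"

text \<open>Harten--Lax--van Leer numerical entropy flux for the wave speeds \<open>\<plusminus>lam\<close>: the formula of the HLL
  flux, with the state replaced by \<open>H\<close> and the physical flux by \<open>Psi\<close>.\<close>

definition hll_entropy_flux ::
    "real \<Rightarrow> ('n::finite state \<Rightarrow> real) \<Rightarrow> ('n state \<Rightarrow> real) \<Rightarrow> 'n state \<Rightarrow> 'n state \<Rightarrow> real"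
  where "hll_entropy_flux lam H Psi WL WR =
    (Psi WL + Psi WR) / 2 - lam / 2 * (H WR - H WL)"

end

theory Submission
  imports Defs "HOL-Real_Asymp.Real_Asymp"
begin

text \<open>The homogeneous Jin--Xin system is diagonal in the characteristic variables
  \<open>w\<^sub>\<plusminus> = u \<plusminus> v / \<lambda>\<close>, in which the domain of the entropy is the product \<open>K\<^sub>+ \<times> K\<^sub>-\<close>. The compatibility
  relation between \<open>H\<close> and \<open>\<Psi>\<close> says that \<open>\<Psi> - \<lambda> H\<close> depends on \<open>w\<^sub>-\<close> only and \<open>\<Psi> + \<lambda> H\<close> on \<open>w\<^sub>+\<close> only
  (lemma \<open>riemann_invariant\<close>). The exact solution of the Riemann problem between two states has a
  single intermediate state, which takes \<open>w\<^sub>+\<close> from the left and \<open>w\<^sub>-\<close> from the right, and the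
  decoupling determines the value of \<open>H\<close> there from the values of \<open>H\<close> and \<open>\<Psi>\<close> at the two data
  (lemma \<open>entropy_jx_middle\<close>). With \<open>c = \<lambda> \<Delta>t / \<Delta>x\<close>, the HLL update is the average of the Riemann
  solutions at the two interfaces of the cell: it gives the weight \<open>c\<close> to each of the two intermediate
  states and \<open>1 - 2 c\<close> to the old state. The CFL condition makes this a convex combination, and
  Jensen's inequality for \<open>H\<close> is the discrete entropy inequality of the HLL scheme
  (lemma \<open>hll_entropy_inequality\<close>).

  For the scheme with relaxation, the defect
  \<open>D\<^sub>j = (H(W\<^sub>j\<^sup>n\<^sup>+\<^sup>1) - H(W\<^sub>j\<^sup>H\<^sup>L\<^sup>L)) / \<Delta>t\<close> gives the inequality at once, and only its
  consistency has content. The difference of the two updates, divided by \<open>\<Delta>t\<close>, is computed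
  explicitly (lemma \<open>jx_step_minus_hll_step\<close>). All its terms are bounded multiples of spatial
  differences, thanks to the CFL bound on \<open>\<Delta>t / \<Delta>x\<close>, except the relaxation term
  \<open>(1 - exp (- \<Delta>t / \<epsilon>)) / \<Delta>t * (g(u) - v)\<close> in the second component, which tends to
  \<open>(g(u) - v) / \<epsilon>\<close>. As \<open>H\<close> is continuously differentiable on a convex set, the mean value theorem
  turns this into the limit of \<open>D\<^sub>j\<close> (lemma \<open>C1_on_difference_quotient\<close>).\<close>

section \<open>Continuously differentiable functions on a convex set\<close>

lemma convex_segment_mvt:
  fixes f :: "'a::real_normed_vector \<Rightarrow> real"
  assumes "convex S" and "a \<in> S" and "b \<in> S"
    and der: "\<And>x. x \<in> S \<Longrightarrow> (f has_derivative blinfun_apply (f' x)) (at x within S)"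
  shows "\<exists>t\<in>{0..1}. a + t *\<^sub>R (b - a) \<in> S
    \<and> f b - f a = blinfun_apply (f' (a + t *\<^sub>R (b - a))) (b - a)"
proof -
  define \<gamma> where "\<gamma> = (\<lambda>t::real. a + t *\<^sub>R (b - a))"
  have in_S: "\<gamma> t \<in> S" if "t \<in> {0..1}" for t
  proof -
    have "(1 - t) *\<^sub>R a + t *\<^sub>R b \<in> S"
      using convexD[OF assms(1-3), of "1 - t" t] that by auto
    then show ?thesis by (simp add: \<gamma>_def algebra_simps)
  qed
  have d\<gamma>: "((\<lambda>t. f (\<gamma> t)) has_derivative (\<lambda>h. f' (\<gamma> t) (h *\<^sub>R (b - a)))) (at t within {0..1})"
    if "t \<in> {0..1}" for t
  proof -
    have "(\<gamma> has_derivative (\<lambda>h. h *\<^sub>R (b - a))) (at t within {0..1})"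
      unfolding \<gamma>_def by (auto intro!: derivative_eq_intros)
    moreover have "(f has_derivative blinfun_apply (f' (\<gamma> t))) (at (\<gamma> t) within \<gamma> ` {0..1})"
      using in_S that by (intro has_derivative_subset[OF der]) auto
    ultimately show ?thesis
      by (rule has_derivative_in_compose)
  qed
  have "\<exists>t\<in>{0..1}. f (\<gamma> 1) - f (\<gamma> 0) = f' (\<gamma> t) ((1 - 0) *\<^sub>R (b - a))"
    by (rule mvt_very_simple[of 0 1, where f' = "\<lambda>t h. f' (\<gamma> t) (h *\<^sub>R (b - a))"])
       (use d\<gamma> in auto)
  then show ?thesis
    using in_S by (auto simp: \<gamma>_def)
qed

text \<open>Continuity of the derivative makes \<open>f\<close> strictly differentiable at \<open>p\<close>: both ends of the
  increment may move. In the application they are the two updates of the scheme, neither of which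
  is fixed in the limit.\<close>

lemma C1_on_difference_quotient:
  fixes f :: "'a::real_normed_vector \<Rightarrow> real"
  assumes "C1_on S f f'" and "convex S" and "p \<in> S"
    and "\<forall>\<^sub>F x in F. a x \<in> S" and "\<forall>\<^sub>F x in F. b x \<in> S"
    and a: "(a \<longlongrightarrow> p) F" and b: "(b \<longlongrightarrow> p) F"
    and d: "((\<lambda>x. (1 / r x) *\<^sub>R (b x - a x)) \<longlongrightarrow> d) F"
  shows "((\<lambda>x. (f (b x) - f (a x)) / r x) \<longlongrightarrow> blinfun_apply (f' p) d) F"
proof -
  have "\<exists>t. t \<in> {0..1} \<and> (a x \<in> S \<and> b x \<in> S \<longrightarrow> a x + t *\<^sub>R (b x - a x) \<in> S
      \<and> f (b x) - f (a x) = f' (a x + t *\<^sub>R (b x - a x)) (b x - a x))" for x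
  proof (cases "a x \<in> S \<and> b x \<in> S")
    case True
    then show ?thesis
      using convex_segment_mvt[of S "a x" "b x" f f'] assms(1,2) by (auto simp: C1_on_def)
  next
    case False
    then show ?thesis by (intro exI[of _ 0]) auto
  qed
  then obtain t where t: "\<And>x. t x \<in> {0..1::real}"
    and mv: "\<And>x. a x \<in> S \<Longrightarrow> b x \<in> S \<Longrightarrow> a x + t x *\<^sub>R (b x - a x) \<in> S
      \<and> f (b x) - f (a x) = f' (a x + t x *\<^sub>R (b x - a x)) (b x - a x)"
    by metis
  define \<xi> where "\<xi> = (\<lambda>x. a x + t x *\<^sub>R (b x - a x))"
  have "((\<lambda>x. b x - a x) \<longlongrightarrow> 0) F"
    using tendsto_diff[OF b a] by simp
  then have "((\<lambda>x. t x *\<^sub>R (b x - a x)) \<longlongrightarrow> 0) F"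
    by (rule Lim_null_comparison[rotated, OF tendsto_norm_zero])
       (use t in \<open>auto intro!: always_eventually mult_left_le_one_le\<close>)
  from tendsto_add[OF a this] have "(\<xi> \<longlongrightarrow> p) F"
    by (simp add: \<xi>_def)
  moreover have both: "\<forall>\<^sub>F x in F. a x \<in> S \<and> b x \<in> S"
    using assms(4,5) by (rule eventually_conj)
  then have "\<forall>\<^sub>F x in F. \<xi> x \<in> S"
    by (rule eventually_mono) (use mv in \<open>auto simp: \<xi>_def\<close>)
  ultimately have "((\<lambda>x. f' (\<xi> x)) \<longlongrightarrow> f' p) F"
    using assms(1,3) by (auto simp: C1_on_def intro: continuous_on_tendsto_compose)
  then have "((\<lambda>x. f' (\<xi> x) ((1 / r x) *\<^sub>R (b x - a x))) \<longlongrightarrow> f' p d) F"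
    by (intro blinfun.tendsto d)
  moreover have "\<forall>\<^sub>F x in F. f' (\<xi> x) ((1 / r x) *\<^sub>R (b x - a x)) = (f (b x) - f (a x)) / r x"
    using both by (rule eventually_mono) (use mv in \<open>auto simp: \<xi>_def blinfun.scaleR_right\<close>)
  ultimately show ?thesis
    by (rule Lim_transform_eventually)
qed

lemma tendsto_bounded_mult_zero:
  fixes c :: "'a \<Rightarrow> real" and y :: "'a \<Rightarrow> 'b::real_normed_vector"
  assumes "\<forall>\<^sub>F x in F. \<bar>c x\<bar> \<le> B" and "(y \<longlongrightarrow> 0) F"
  shows "((\<lambda>x. c x *\<^sub>R y x) \<longlongrightarrow> 0) F"
proof (rule Lim_null_comparison)
  show "\<forall>\<^sub>F x in F. norm (c x *\<^sub>R y x) \<le> B * norm (y x)"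
    using assms(1) by (rule eventually_mono) (auto intro: mult_right_mono)
  show "((\<lambda>x. B * norm (y x)) \<longlongrightarrow> 0) F"
    using tendsto_mult_right_zero[OF tendsto_norm_zero[OF assms(2)]] .
qed

section \<open>Characteristic variables and the HLL scheme\<close>

lemma convex_jx_domain:
  assumes "convex (K_plus lam g K)" and "convex (K_minus lam g K)"
  shows "convex (jx_domain lam g K)"
proof -
  have lin: "linear (\<lambda>(u, v). u + (1 / lam) *\<^sub>R v)" "linear (\<lambda>(u, v). u - (1 / lam) *\<^sub>R v)"
    for lam :: real and u v :: "real^'n"
    by (auto simp: linear_iff algebra_simps)
  have "jx_domain lam g K
      = (\<lambda>(u, v). u + (1 / lam) *\<^sub>R v) -` K_plus lam g K
        \<inter> (\<lambda>(u, v). u - (1 / lam) *\<^sub>R v) -` K_minus lam g K"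
    by (auto simp: jx_domain_def)
  then show ?thesis
    using assms lin by (auto intro!: convex_Int convex_linear_vimage)
qed

lemma jx_domain_fst:
  assumes "K = {(1 / 2) *\<^sub>R (a + b) | a b. a \<in> K_plus lam g K \<and> b \<in> K_minus lam g K}"
    and "W \<in> jx_domain lam g K"
  shows "fst W \<in> K"
proof -
  obtain u v where W: "W = (u, v)" by (cases W)
  have "u = (1 / 2) *\<^sub>R ((u + (1 / lam) *\<^sub>R v) + (u - (1 / lam) *\<^sub>R v))"
    by (simp flip: scaleR_2)
  then have "u \<in> {(1 / 2) *\<^sub>R (a + b) | a b. a \<in> K_plus lam g K \<and> b \<in> K_minus lam g K}"
    using assms(2) unfolding W jx_domain_def by blast
  then show ?thesis
    using assms(1) unfolding W fst_conv by (rule ssubst[rotated])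
qed

text \<open>The state with the characteristic variable \<open>w\<^sub>+\<close> of the first argument and \<open>w\<^sub>-\<close> of the second:
  the intermediate state of the Riemann problem.\<close>

definition jx_middle :: "real \<Rightarrow> 'n::finite state \<Rightarrow> 'n state \<Rightarrow> 'n state"
  where "jx_middle lam = (\<lambda>(uL, vL) (uR, vR).
    ((1 / 2) *\<^sub>R (uL + uR) - (1 / (2 * lam)) *\<^sub>R (vR - vL),
     (1 / 2) *\<^sub>R (vL + vR) - (lam / 2) *\<^sub>R (uR - uL)))"

lemma jx_middle_plus:
  assumes "lam \<noteq> 0"
  shows "fst (jx_middle lam WL WR) + (1 / lam) *\<^sub>R snd (jx_middle lam WL WR)
    = fst WL + (1 / lam) *\<^sub>R snd WL"
  using assms by (simp add: jx_middle_def split_beta vec_eq_iff field_simps)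

lemma jx_middle_minus:
  assumes "lam \<noteq> 0"
  shows "fst (jx_middle lam WL WR) - (1 / lam) *\<^sub>R snd (jx_middle lam WL WR)
    = fst WR - (1 / lam) *\<^sub>R snd WR"
  using assms by (simp add: jx_middle_def split_beta vec_eq_iff field_simps)

lemma jx_middle_in_domain:
  assumes "lam \<noteq> 0" and "WL \<in> jx_domain lam g K" and "WR \<in> jx_domain lam g K"
  shows "jx_middle lam WL WR \<in> jx_domain lam g K"
  using assms jx_middle_plus[of lam WL WR] jx_middle_minus[of lam WL WR]
  by (simp add: jx_domain_def split_beta)

lemma hll_step_eq_average:
  assumes "lam \<noteq> 0" and "c = lam * dt / dx"
  shows "hll_step lam dt dx WL W WR
    = (1 - 2 * c) *\<^sub>R W + c *\<^sub>R jx_middle lam WL W + c *\<^sub>R jx_middle lam W WR"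
proof -
  have r: "dt / dx = c / lam"
    using assms by simp
  show ?thesis
    using assms(1) unfolding r hll_step_def jx_middle_def split_beta
    by (simp add: prod_eq_iff vec_eq_iff field_simps power2_eq_square)
qed

lemma convex_combination3:
  fixes x y z :: "'a::real_vector"
  assumes "convex S" and "x \<in> S" "y \<in> S" "z \<in> S" and "0 \<le> c" "c \<le> 1 / 2"
  shows "(1 - 2 * c) *\<^sub>R x + c *\<^sub>R y + c *\<^sub>R z \<in> S"
    and "convex_on S f \<Longrightarrow>
      f ((1 - 2 * c) *\<^sub>R x + c *\<^sub>R y + c *\<^sub>R z) \<le> (1 - 2 * c) * f x + c * f y + c * f z"
proof -
  define m where "m = (1 / 2) *\<^sub>R y + (1 / 2) *\<^sub>R z"
  have m: "m \<in> S"
    unfolding m_def using assms by (intro convexD) auto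
  have eq: "(1 - 2 * c) *\<^sub>R x + c *\<^sub>R y + c *\<^sub>R z = (1 - 2 * c) *\<^sub>R x + (2 * c) *\<^sub>R m"
    by (simp add: m_def algebra_simps)
  show "(1 - 2 * c) *\<^sub>R x + c *\<^sub>R y + c *\<^sub>R z \<in> S"
    unfolding eq using assms m by (intro convexD) auto
  assume f: "convex_on S f"
  have "f m \<le> (1 / 2) * f y + (1 / 2) * f z"
    unfolding m_def using convex_onD[OF f, of "1 / 2" y z] assms by simp
  then have "2 * c * f m \<le> c * f y + c * f z"
    using mult_left_mono[of "f m" "(1 / 2) * f y + (1 / 2) * f z" "2 * c"] assms(5)
    by (simp add: algebra_simps)
  moreover have "f ((1 - 2 * c) *\<^sub>R x + (2 * c) *\<^sub>R m) \<le> (1 - 2 * c) * f x + 2 * c * f m"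
    using convex_onD[OF f, of "2 * c" x m] assms m by simp
  ultimately show "f ((1 - 2 * c) *\<^sub>R x + c *\<^sub>R y + c *\<^sub>R z) \<le> (1 - 2 * c) * f x + c * f y + c * f z"
    unfolding eq by simp
qed

lemma hll_step_in_domain:
  assumes "lam > 0" and "convex (jx_domain lam g K)" and "0 < dt" "0 < dx" "lam * dt / dx \<le> 1 / 2"
    and "WL \<in> jx_domain lam g K" "W \<in> jx_domain lam g K" "WR \<in> jx_domain lam g K"
  shows "hll_step lam dt dx WL W WR \<in> jx_domain lam g K"
proof -
  have lam: "lam \<noteq> 0" using assms(1) by simp
  show ?thesis
    unfolding hll_step_eq_average[OF lam refl]
    by (rule convex_combination3(1)[OF assms(2)])
       (use assms in \<open>auto simp: jx_middle_in_domain[OF lam]\<close>)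
qed

text \<open>Varying \<open>w\<^sub>+\<close> at fixed \<open>w\<^sub>-\<close> moves the state along an eigenvector of the flux for the eigenvalue
  \<open>\<lambda>\<close>, on which \<open>D\<Psi> = \<lambda> DH\<close>; the statement with \<open>-\<lambda>\<close> exchanges the roles. One lemma covers both
  with \<open>s = \<lambda>\<close> and \<open>s = -\<lambda>\<close>.\<close>

lemma riemann_invariant:
  fixes H Psi :: "'n::finite state \<Rightarrow> real"
  assumes pair: "convex_entropy_pair S (\<lambda>_. jx_flux lam) H H' Psi" and "convex S"
    and "X \<in> S" "Y \<in> S" and "s\<^sup>2 = lam\<^sup>2" and dir: "snd Y - snd X = s *\<^sub>R (fst Y - fst X)"
  shows "Psi X - s * H X = Psi Y - s * H Y"
proof -
  obtain Psi' where H: "C1_on S H H'" and Psi: "C1_on S Psi Psi'"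
    and compat: "\<And>x h. x \<in> S \<Longrightarrow> blinfun_apply (Psi' x) h = blinfun_apply (H' x) (jx_flux lam h)"
    using pair by (auto simp: convex_entropy_pair_def)
  have eigen: "jx_flux lam (Y - X) = s *\<^sub>R (Y - X)"
    using assms(5) dir by (simp add: jx_flux_def split_beta prod_eq_iff power2_eq_square)
  have "((\<lambda>x. Psi x - s * H x) has_derivative blinfun_apply (Psi' x - s *\<^sub>R H' x)) (at x within S)"
    if "x \<in> S" for x
    using H Psi that
    by (auto simp: C1_on_def blinfun.diff_left blinfun.scaleR_left intro!: derivative_eq_intros)
  from convex_segment_mvt[OF assms(2-4) this] obtain \<xi> where "\<xi> \<in> S"
    and "(Psi Y - s * H Y) - (Psi X - s * H X) = (Psi' \<xi> - s *\<^sub>R H' \<xi>) (Y - X)"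
    by blast
  then show ?thesis
    by (simp add: blinfun.diff_left blinfun.scaleR_left blinfun.scaleR_right compat eigen)
qed

lemma entropy_jx_middle:
  fixes H Psi :: "'n::finite state \<Rightarrow> real"
  assumes "lam > 0" and pair: "convex_entropy_pair (jx_domain lam g K) (\<lambda>_. jx_flux lam) H H' Psi"
    and conv: "convex (jx_domain lam g K)"
    and W: "WL \<in> jx_domain lam g K" "WR \<in> jx_domain lam g K"
  shows "2 * lam * H (jx_middle lam WL WR) = (lam * H WL + Psi WL) + (lam * H WR - Psi WR)"
proof -
  let ?M = "jx_middle lam WL WR"
  have lam: "lam \<noteq> 0" using assms(1) by simp
  have M: "?M \<in> jx_domain lam g K" using jx_middle_in_domain[OF lam W] .
  have "snd ?M - snd WL = (- lam) *\<^sub>R (fst ?M - fst WL)"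
    using lam by (simp add: jx_middle_def split_beta vec_eq_iff field_simps)
  then have "Psi WL + lam * H WL = Psi ?M + lam * H ?M"
    using riemann_invariant[OF pair conv W(1) M, of "- lam"] by simp
  moreover have "snd WR - snd ?M = lam *\<^sub>R (fst WR - fst ?M)"
    using lam by (simp add: jx_middle_def split_beta vec_eq_iff field_simps)
  then have "Psi ?M - lam * H ?M = Psi WR - lam * H WR"
    using riemann_invariant[OF pair conv M W(2), of lam] by simp
  ultimately show ?thesis by simp
qed

text \<open>Jensen's inequality for the average of the two intermediate states and the old state: the
  bound \<open>1 / 2\<close> in the CFL condition keeps the weight of the old state nonnegative.\<close>

lemma hll_entropy_inequality:
  fixes H Psi :: "'n::finite state \<Rightarrow> real"
  assumes "lam > 0" and pair: "convex_entropy_pair (jx_domain lam g K) (\<lambda>_. jx_flux lam) H H' Psi"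
    and conv: "convex (jx_domain lam g K)" and "0 < dt" "0 < dx" "lam * dt / dx \<le> 1 / 2"
    and W: "WL \<in> jx_domain lam g K" "W \<in> jx_domain lam g K" "WR \<in> jx_domain lam g K"
  shows "H (hll_step lam dt dx WL W WR)
    \<le> H W - dt / dx * (hll_entropy_flux lam H Psi W WR - hll_entropy_flux lam H Psi WL W)"
proof -
  define c where "c = lam * dt / dx"
  have lam: "lam \<noteq> 0" using assms(1) by simp
  have c: "0 \<le> c" "c \<le> 1 / 2" using assms by (auto simp: c_def)
  have r: "dt / dx = c / lam" using lam by (simp add: c_def)
  have "H (hll_step lam dt dx WL W WR)
      \<le> (1 - 2 * c) * H W + c * H (jx_middle lam WL W) + c * H (jx_middle lam W WR)"
    unfolding hll_step_eq_average[OF lam c_def]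
    by (rule convex_combination3(2)[OF conv])
       (use c W pair in \<open>auto simp: jx_middle_in_domain[OF lam] convex_entropy_pair_def\<close>)
  also have "H (jx_middle lam WL W) = ((lam * H WL + Psi WL) + (lam * H W - Psi W)) / (2 * lam)"
    using entropy_jx_middle[OF assms(1) pair conv W(1,2)] lam by (simp add: field_simps)
  also have "H (jx_middle lam W WR) = ((lam * H W + Psi W) + (lam * H WR - Psi WR)) / (2 * lam)"
    using entropy_jx_middle[OF assms(1) pair conv W(2,3)] lam by (simp add: field_simps)
  also have "(1 - 2 * c) * H W + c * (((lam * H WL + Psi WL) + (lam * H W - Psi W)) / (2 * lam))
      + c * (((lam * H W + Psi W) + (lam * H WR - Psi WR)) / (2 * lam))
    = H W - dt / dx * (hll_entropy_flux lam H Psi W WR - hll_entropy_flux lam H Psi WL W)"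
    unfolding r hll_entropy_flux_def using lam by (simp add: field_simps)
  finally show ?thesis .
qed

section \<open>The relaxation source term\<close>

text \<open>With \<open>A = (1 - exp (- \<Delta>t / \<epsilon>)) / \<Delta>t\<close> and \<open>B = (1 - \<epsilon> A) / \<Delta>t\<close>, which have the limits \<open>1 / \<epsilon>\<close> and
  \<open>1 / (2 \<epsilon>)\<close>, the difference of the two updates carries a factor \<open>\<Delta>t\<close>. What remains of the mesh is
  the ratio \<open>\<Delta>t / \<Delta>x\<close>, and it always multiplies a spatial difference.\<close>

lemma jx_step_minus_hll_step:
  assumes "dt \<noteq> 0" and A: "A = (1 - exp (- dt / eps)) / dt" and B: "B = (1 - eps * A) / dt"
  shows "(1 / dt) *\<^sub>R (jx_step lam eps g dt dx WL W WR - hll_step lam dt dx WL W WR)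
    = ((dt / dx) *\<^sub>R ((A / 2) *\<^sub>R ((snd WR - g (fst WR)) - (snd WL - g (fst WL)))),
       (dt / dx) *\<^sub>R ((B * lam\<^sup>2 / 2) *\<^sub>R (fst WR - fst WL)
                    - (A * lam / 2) *\<^sub>R (snd WR - 2 *\<^sub>R snd W + snd WL))
       + A *\<^sub>R (g (fst (jx_step lam eps g dt dx WL W WR)) - snd W))"
proof (cases "dx = 0")
  case True
  then show ?thesis using assms(1)
    by (simp add: jx_step_def jx_step_u_def jx_step_v_def hll_step_def split_beta A prod_eq_iff
        vec_eq_iff field_simps)
next
  case False
  define e where "e = exp (- dt / eps)"
  define G where "G = g (fst (jx_step lam eps g dt dx WL W WR))"
  have v: "snd (jx_step lam eps g dt dx WL W WR) = snd W - (dt / dx) *\<^sub>R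
      (- (lam * e / 2) *\<^sub>R (snd WR - 2 *\<^sub>R snd W + snd WL)
       - (lam\<^sup>2 * eps * (e - 1) / (2 * dt)) *\<^sub>R (fst WR - fst WL)) - (e - 1) *\<^sub>R (G - snd W)"
    by (simp add: jx_step_def jx_step_v_def G_def e_def split_beta)
  have u: "fst (jx_step lam eps g dt dx WL W WR) = fst W - (dt / dx) *\<^sub>R
      (- (lam / 2) *\<^sub>R (fst WR - 2 *\<^sub>R fst W + fst WL)
       + (1 / 2) *\<^sub>R (e *\<^sub>R (snd WR - g (fst WR)) + g (fst WR)
                    - e *\<^sub>R (snd WL - g (fst WL)) - g (fst WL)))"
    by (simp add: jx_step_def jx_step_u_def e_def split_beta)
  have "fst ((1 / dt) *\<^sub>R (jx_step lam eps g dt dx WL W WR - hll_step lam dt dx WL W WR))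
      = (dt / dx) *\<^sub>R ((A / 2) *\<^sub>R ((snd WR - g (fst WR)) - (snd WL - g (fst WL))))"
    using assms(1) False unfolding fst_scaleR fst_diff u A e_def[symmetric]
    by (simp add: hll_step_def split_beta vec_eq_iff field_simps)
  moreover have "snd ((1 / dt) *\<^sub>R (jx_step lam eps g dt dx WL W WR - hll_step lam dt dx WL W WR))
      = (dt / dx) *\<^sub>R ((B * lam\<^sup>2 / 2) *\<^sub>R (fst WR - fst WL)
                    - (A * lam / 2) *\<^sub>R (snd WR - 2 *\<^sub>R snd W + snd WL))
       + A *\<^sub>R (G - snd W)"
    using assms(1) False unfolding snd_scaleR snd_diff v B A e_def[symmetric]
    by (simp add: hll_step_def split_beta vec_eq_iff field_simps power2_eq_square)
  ultimately show ?thesis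
    by (simp add: prod_eq_iff G_def)
qed

text \<open>The limit is taken along an arbitrary filter, so that the five arguments of the scheme are
  functions with separate limits instead of projections of a tuple.\<close>

lemma jx_dissipation_consistent:
  fixes H :: "'n::finite state \<Rightarrow> real" and WL W WR :: "'b \<Rightarrow> 'n state"
  assumes "0 < eps" and "0 < lam" and H: "C1_on (jx_domain lam g K) H H'"
    and conv: "convex (jx_domain lam g K)" and g: "continuous_on K g"
    and fst_K: "\<And>W. W \<in> jx_domain lam g K \<Longrightarrow> fst W \<in> K"
    and dt: "(dt \<longlongrightarrow> 0) F"
    and lims: "(WL \<longlongrightarrow> p) F" "(W \<longlongrightarrow> p) F" "(WR \<longlongrightarrow> p) F" and p: "p \<in> jx_domain lam g K"
    and ev: "\<forall>\<^sub>F x in F. 0 < dt x \<and> 0 < dx x \<and> lam * dt x / dx x \<le> 1 / 2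
      \<and> WL x \<in> jx_domain lam g K \<and> W x \<in> jx_domain lam g K \<and> WR x \<in> jx_domain lam g K
      \<and> jx_step lam eps g (dt x) (dx x) (WL x) (W x) (WR x) \<in> jx_domain lam g K"
  shows "((\<lambda>x. (H (jx_step lam eps g (dt x) (dx x) (WL x) (W x) (WR x))
      - H (hll_step lam (dt x) (dx x) (WL x) (W x) (WR x))) / dt x)
    \<longlongrightarrow> 1 / eps * blinfun_apply (H' p) (0, g (fst p) - snd p)) F"
proof -
  define A where "A = (\<lambda>x. (1 - exp (- dt x / eps)) / dt x)"
  define B where "B = (\<lambda>x. (1 - eps * A x) / dt x)"
  define J where "J = (\<lambda>x. jx_step lam eps g (dt x) (dx x) (WL x) (W x) (WR x))"
  define L where "L = (\<lambda>x. hll_step lam (dt x) (dx x) (WL x) (W x) (WR x))"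
  define d where "d = (\<lambda>x. ((dt x / dx x) *\<^sub>R
      ((A x / 2) *\<^sub>R ((snd (WR x) - g (fst (WR x))) - (snd (WL x) - g (fst (WL x))))),
    (dt x / dx x) *\<^sub>R ((B x * lam\<^sup>2 / 2) *\<^sub>R (fst (WR x) - fst (WL x))
      - (A x * lam / 2) *\<^sub>R (snd (WR x) - 2 *\<^sub>R snd (W x) + snd (WL x)))
    + A x *\<^sub>R (g (fst (J x)) - snd (W x))))"
  have dt0: "filterlim dt (at_right 0) F"
    using dt ev by (auto simp: filterlim_at elim: eventually_mono)
  have "((\<lambda>h. (1 - exp (- h / eps)) / h) \<longlongrightarrow> inverse eps) (at_right 0)"
    using assms(1) by real_asymp
  from filterlim_compose[OF this dt0] have A: "(A \<longlongrightarrow> 1 / eps) F"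
    by (simp add: A_def inverse_eq_divide)
  have half: "1 / (2 * eps) = eps * (inverse eps * inverse eps) / 2"
    using assms(1) by (simp add: field_simps)
  have "((\<lambda>h. (1 - eps * ((1 - exp (- h / eps)) / h)) / h) \<longlongrightarrow> 1 / (2 * eps)) (at_right 0)"
    unfolding half using assms(1) by real_asymp
  from filterlim_compose[OF this dt0] have B: "(B \<longlongrightarrow> 1 / (2 * eps)) F"
    by (simp add: B_def A_def)
  have cfl: "\<forall>\<^sub>F x in F. \<bar>dt x / dx x\<bar> \<le> 1 / (2 * lam)"
    using ev by (rule eventually_mono) (use assms(2) in \<open>auto simp: field_simps\<close>)
  have ev_J: "\<forall>\<^sub>F x in F. J x \<in> jx_domain lam g K"
    using ev by (rule eventually_mono) (simp add: J_def)
  have ev_L: "\<forall>\<^sub>F x in F. L x \<in> jx_domain lam g K"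
    using ev by (rule eventually_mono)
      (unfold L_def, intro hll_step_in_domain[OF assms(2) conv], simp_all)
  have diff_eq: "\<forall>\<^sub>F x in F. (1 / dt x) *\<^sub>R (J x - L x) = d x"
    using ev
    by (rule eventually_mono)
       (auto simp: J_def L_def d_def A_def B_def jx_step_minus_hll_step[OF _ refl refl])
  have J_eq: "\<forall>\<^sub>F x in F. L x + dt x *\<^sub>R d x = J x"
    using eventually_conj[OF ev diff_eq]
  proof (rule eventually_mono)
    fix x assume x: "(0 < dt x \<and> 0 < dx x \<and> lam * dt x / dx x \<le> 1 / 2
      \<and> WL x \<in> jx_domain lam g K \<and> W x \<in> jx_domain lam g K \<and> WR x \<in> jx_domain lam g K
      \<and> jx_step lam eps g (dt x) (dx x) (WL x) (W x) (WR x) \<in> jx_domain lam g K)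
      \<and> (1 / dt x) *\<^sub>R (J x - L x) = d x"
    then have "d x = (1 / dt x) *\<^sub>R (J x - L x)" and "dt x \<noteq> 0" by auto
    then show "L x + dt x *\<^sub>R d x = J x" by simp
  qed
  have g_lim: "((\<lambda>x. g (fst (X x))) \<longlongrightarrow> g (fst p)) F"
    if "((\<lambda>x. fst (X x)) \<longlongrightarrow> fst p) F" "\<forall>\<^sub>F x in F. X x \<in> jx_domain lam g K"
    for X :: "'b \<Rightarrow> 'n state"
    using continuous_on_tendsto_compose[OF g that(1) fst_K[OF p]]
      eventually_mono[OF that(2) fst_K] by simp
  have gL: "((\<lambda>x. g (fst (WL x))) \<longlongrightarrow> g (fst p)) F" and gR: "((\<lambda>x. g (fst (WR x))) \<longlongrightarrow> g (fst p)) F"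
    using ev by (auto intro!: g_lim tendsto_fst lims elim: eventually_mono)
  have diffs: "((\<lambda>x. fst (WR x) - fst (WL x)) \<longlongrightarrow> 0) F" "((\<lambda>x. snd (WR x) - snd (WL x)) \<longlongrightarrow> 0) F"
    using tendsto_diff[OF lims(3,1)[THEN tendsto_fst]] tendsto_diff[OF lims(3,1)[THEN tendsto_snd]]
    by simp_all
  have second_diffs: "((\<lambda>x. fst (WR x) - 2 *\<^sub>R fst (W x) + fst (WL x)) \<longlongrightarrow> 0) F"
    "((\<lambda>x. snd (WR x) - 2 *\<^sub>R snd (W x) + snd (WL x)) \<longlongrightarrow> 0) F"
  proof -
    have zero: "x - 2 *\<^sub>R x + x = 0" for x :: "real^'n"
      by (simp add: vec_eq_iff)
    note lim = tendsto_add[OF tendsto_diff[OF _ tendsto_scaleR[OF tendsto_const]]]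
    show "((\<lambda>x. fst (WR x) - 2 *\<^sub>R fst (W x) + fst (WL x)) \<longlongrightarrow> 0) F"
      using lim[OF lims(3,2,1)[THEN tendsto_fst], of 2] unfolding zero .
    show "((\<lambda>x. snd (WR x) - 2 *\<^sub>R snd (W x) + snd (WL x)) \<longlongrightarrow> 0) F"
      using lim[OF lims(3,2,1)[THEN tendsto_snd], of 2] unfolding zero .
  qed
  have d1: "((\<lambda>x. fst (d x)) \<longlongrightarrow> 0) F"
    unfolding d_def fst_conv
    by (rule tendsto_bounded_mult_zero[OF cfl])
       (auto intro!: tendsto_eq_intros A gL gR lims)
  have d2: "((\<lambda>x. (dt x / dx x) *\<^sub>R ((B x * lam\<^sup>2 / 2) *\<^sub>R (fst (WR x) - fst (WL x))
      - (A x * lam / 2) *\<^sub>R (snd (WR x) - 2 *\<^sub>R snd (W x) + snd (WL x)))) \<longlongrightarrow> 0) F"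
  proof (rule tendsto_bounded_mult_zero[OF cfl])
    have "((\<lambda>x. B x * lam\<^sup>2 / 2) \<longlongrightarrow> 1 / (2 * eps) * lam\<^sup>2 / 2) F"
      and "((\<lambda>x. A x * lam / 2) \<longlongrightarrow> 1 / eps * lam / 2) F"
      by (rule tendsto_intros A B | simp)+
    from tendsto_diff[OF tendsto_scaleR[OF this(1) diffs(1)]
        tendsto_scaleR[OF this(2) second_diffs(2)]]
    show "((\<lambda>x. (B x * lam\<^sup>2 / 2) *\<^sub>R (fst (WR x) - fst (WL x))
      - (A x * lam / 2) *\<^sub>R (snd (WR x) - 2 *\<^sub>R snd (W x) + snd (WL x))) \<longlongrightarrow> 0) F"
      unfolding scaleR_zero_right diff_zero .
  qed
  have L: "(L \<longlongrightarrow> p) F"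
  proof -
    have vanish: "((\<lambda>x. (dt x / dx x) *\<^sub>R (a *\<^sub>R X x + b *\<^sub>R Y x)) \<longlongrightarrow> 0) F"
      if "(X \<longlongrightarrow> 0) F" "(Y \<longlongrightarrow> 0) F" for X Y :: "'b \<Rightarrow> real^'n" and a b :: real
      using tendsto_add[OF tendsto_scaleR[OF tendsto_const that(1)]
          tendsto_scaleR[OF tendsto_const that(2)]]
      by (intro tendsto_bounded_mult_zero[OF cfl]) simp
    note vanish[OF second_diffs(1) diffs(2), of "- (lam / 2)" "1 / 2"]
    moreover note vanish[OF second_diffs(2) diffs(1), of "- (lam / 2)" "lam\<^sup>2 / 2"]
    ultimately have "((\<lambda>x. W x - L x) \<longlongrightarrow> (0, 0)) F"
      unfolding L_def hll_step_def split_beta by (auto intro!: tendsto_Pair simp: minus_prod_def)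
    from tendsto_diff[OF lims(2) this] show ?thesis by (simp flip: zero_prod_def)
  qed
  \<comment> \<open>The second component of the update contains \<open>g\<close> at the updated \<open>u\<close>, so the convergence of the
    first component has to be known before that of \<open>d\<close> and of the whole update.\<close>
  have fst_J: "((\<lambda>x. fst (J x)) \<longlongrightarrow> fst p) F"
  proof -
    have "((\<lambda>x. fst (L x) + dt x *\<^sub>R fst (d x)) \<longlongrightarrow> fst p) F"
      using tendsto_add[OF tendsto_fst[OF L] tendsto_scaleR[OF dt d1]] by simp
    moreover have "\<forall>\<^sub>F x in F. fst (L x) + dt x *\<^sub>R fst (d x) = fst (J x)"
      using J_eq by (rule eventually_mono) (metis fst_add fst_scaleR)
    ultimately show ?thesis by (rule Lim_transform_eventually)
  qed
  have "((\<lambda>x. g (fst (J x))) \<longlongrightarrow> g (fst p)) F"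
    using fst_J ev_J by (rule g_lim)
  then have "((\<lambda>x. A x *\<^sub>R (g (fst (J x)) - snd (W x))) \<longlongrightarrow> (1 / eps) *\<^sub>R (g (fst p) - snd p)) F"
    by (intro tendsto_intros A lims)
  from tendsto_Pair[OF d1 tendsto_add[OF d2 this]]
  have d: "(d \<longlongrightarrow> (0, (1 / eps) *\<^sub>R (g (fst p) - snd p))) F"
    by (simp add: d_def)
  have J: "(J \<longlongrightarrow> p) F"
  proof -
    have "((\<lambda>x. L x + dt x *\<^sub>R d x) \<longlongrightarrow> p) F"
      using tendsto_add[OF L tendsto_scaleR[OF dt d]] unfolding scaleR_zero_left add_0_right .
    from Lim_transform_eventually[OF this J_eq] show ?thesis .
  qed
  have "((\<lambda>x. (1 / dt x) *\<^sub>R (J x - L x)) \<longlongrightarrow> (0, (1 / eps) *\<^sub>R (g (fst p) - snd p))) F"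
    by (rule Lim_transform_eventually[OF d]) (use diff_eq in \<open>auto elim: eventually_mono\<close>)
  from C1_on_difference_quotient[OF H conv p ev_L ev_J L J this]
  have "((\<lambda>x. (H (J x) - H (L x)) / dt x)
    \<longlongrightarrow> blinfun_apply (H' p) ((1 / eps) *\<^sub>R (0, g (fst p) - snd p))) F"
    by simp
  then show ?thesis
    unfolding J_def L_def blinfun.scaleR_right real_scaleR_def .
qed

section \<open>The discrete entropy inequality\<close>

theorem mainTheorem5:
  fixes lam eps :: real
    and K :: "(real^'n) set"
    and g :: "real^'n \<Rightarrow> real^'n" and g' :: "real^'n \<Rightarrow> (real^'n) \<Rightarrow>\<^sub>L (real^'n)"
    and eta q :: "real^'n \<Rightarrow> real" and eta' :: "real^'n \<Rightarrow> (real^'n) \<Rightarrow>\<^sub>L real"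
    and H Psi :: "'n state \<Rightarrow> real" and H' :: "'n state \<Rightarrow> 'n state \<Rightarrow>\<^sub>L real"
  assumes eps_pos: "0 < eps" and lam_pos: "0 < lam"
    and K_convex: "convex K"
    and g_C2: "C2_on K g g'"
    and eta_q: "convex_entropy_pair K (\<lambda>u. blinfun_apply (g' u)) eta eta' q"
    and K_pm_convex: "convex (K_plus lam g K)" "convex (K_minus lam g K)"
    and K_half_sum: "K = {(1 / 2) *\<^sub>R (a + b) | a b. a \<in> K_plus lam g K \<and> b \<in> K_minus lam g K}"
    and subcharacteristic: "\<And>u. u \<in> K \<Longrightarrow> spectral_radius (matrix (blinfun_apply (g' u))) < lam"
    and H_Psi: "convex_entropy_pair (jx_domain lam g K) (\<lambda>_. jx_flux lam) H H' Psi"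
    and extension: "\<And>u. u \<in> K \<Longrightarrow> H (u, g u) = eta u \<and> Psi (u, g u) = q u"
    and dissipative: "\<And>u v. (u, v) \<in> jx_domain lam g K \<Longrightarrow> blinfun_apply (H' (u, v)) (0, g u - v) \<le> 0"
  shows
    "(\<forall>W \<in> jx_domain lam g K. hll_entropy_flux lam H Psi W W = Psi W)
     \<and> (\<forall>dt dx. \<forall>W :: int \<Rightarrow> 'n state.
          0 < dt \<and> 0 < dx \<and> lam * dt / dx \<le> 1 / 2 \<and> (\<forall>j. W j \<in> jx_domain lam g K) \<longrightarrow>
          (\<forall>j. H (hll_step lam dt dx (W (j - 1)) (W j) (W (j + 1)))
               \<le> H (W j) - dt / dx * (hll_entropy_flux lam H Psi (W j) (W (j + 1))
                                      - hll_entropy_flux lam H Psi (W (j - 1)) (W j))))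
     \<and> (\<exists>D :: real \<Rightarrow> real \<Rightarrow> 'n state \<Rightarrow> 'n state \<Rightarrow> 'n state \<Rightarrow> real.
          (\<forall>dt dx. \<forall>W :: int \<Rightarrow> 'n state.
             0 < dt \<and> 0 < dx \<and> lam * dt / dx \<le> 1 / 2 \<and> (\<forall>j. W j \<in> jx_domain lam g K) \<longrightarrow>
             (\<forall>j. jx_step lam eps g dt dx (W (j - 1)) (W j) (W (j + 1)) \<in> jx_domain lam g K \<longrightarrow>
                H (jx_step lam eps g dt dx (W (j - 1)) (W j) (W (j + 1)))
                \<le> H (W j) - dt / dx * (hll_entropy_flux lam H Psi (W j) (W (j + 1))
                                       - hll_entropy_flux lam H Psi (W (j - 1)) (W j))
                   + dt * D dt dx (W (j - 1)) (W j) (W (j + 1))))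
          \<and> (\<forall>u v. (u, v) \<in> jx_domain lam g K \<longrightarrow>
             ((\<lambda>(dt, dx, WL, W, WR). D dt dx WL W WR)
               \<longlongrightarrow> 1 / eps * blinfun_apply (H' (u, v)) (0, g u - v))
             (at (0, 0, (u, v), (u, v), (u, v)) within
               {(dt, dx, WL, W, WR). 0 < dt \<and> 0 < dx \<and> lam * dt / dx \<le> 1 / 2
                  \<and> WL \<in> jx_domain lam g K \<and> W \<in> jx_domain lam g K \<and> WR \<in> jx_domain lam g K
                  \<and> jx_step lam eps g dt dx WL W WR \<in> jx_domain lam g K})))"
proof -
  let ?dom = "jx_domain lam g K"
  define D where "D = (\<lambda>dt dx WL W WR.
    (H (jx_step lam eps g dt dx WL W WR) - H (hll_step lam dt dx WL W WR)) / dt)"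
  have conv: "convex ?dom"
    using K_pm_convex by (rule convex_jx_domain)
  have g_cont: "continuous_on K g"
    using g_C2
    by (auto simp: C2_on_def C1_on_def continuous_on_eq_continuous_within
        intro: has_derivative_continuous)
  have H_C1: "C1_on ?dom H H'"
    using H_Psi by (simp add: convex_entropy_pair_def)
  have hll: "H (hll_step lam dt dx (W (j - 1)) (W j) (W (j + 1)))
      \<le> H (W j) - dt / dx * (hll_entropy_flux lam H Psi (W j) (W (j + 1))
                             - hll_entropy_flux lam H Psi (W (j - 1)) (W j))"
    if "0 < dt \<and> 0 < dx \<and> lam * dt / dx \<le> 1 / 2 \<and> (\<forall>j. W j \<in> ?dom)"
    for dt dx :: real and W :: "int \<Rightarrow> 'n state" and j
    using that by (intro hll_entropy_inequality[OF lam_pos H_Psi conv]) auto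
  have step: "H (jx_step lam eps g dt dx (W (j - 1)) (W j) (W (j + 1)))
      \<le> H (W j) - dt / dx * (hll_entropy_flux lam H Psi (W j) (W (j + 1))
                             - hll_entropy_flux lam H Psi (W (j - 1)) (W j))
         + dt * D dt dx (W (j - 1)) (W j) (W (j + 1))"
    if "0 < dt \<and> 0 < dx \<and> lam * dt / dx \<le> 1 / 2 \<and> (\<forall>j. W j \<in> ?dom)"
    for dt dx :: real and W :: "int \<Rightarrow> 'n state" and j
    using hll[OF that, of j] that by (simp add: D_def)
  have consistent: "((\<lambda>(dt, dx, WL, W, WR). D dt dx WL W WR)
      \<longlongrightarrow> 1 / eps * blinfun_apply (H' (u, v)) (0, g u - v))
      (at (0, 0, (u, v), (u, v), (u, v)) within
        {(dt, dx, WL, W, WR). 0 < dt \<and> 0 < dx \<and> lam * dt / dx \<le> 1 / 2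
           \<and> WL \<in> ?dom \<and> W \<in> ?dom \<and> WR \<in> ?dom \<and> jx_step lam eps g dt dx WL W WR \<in> ?dom})"
    (is "(_ \<longlongrightarrow> _) (at ?p within ?S)")
    if "(u, v) \<in> ?dom" for u v
  proof -
    let ?F = "at ?p within ?S"
    note id = tendsto_ident_at[of ?p ?S]
    have lims: "(fst \<longlongrightarrow> 0) ?F" "((\<lambda>x. fst (snd (snd x))) \<longlongrightarrow> (u, v)) ?F"
      "((\<lambda>x. fst (snd (snd (snd x)))) \<longlongrightarrow> (u, v)) ?F"
      "((\<lambda>x. snd (snd (snd (snd x)))) \<longlongrightarrow> (u, v)) ?F"
      by (rule tendsto_eq_rhs, (rule tendsto_fst tendsto_snd id)+, simp)+
    have "\<forall>\<^sub>F x in ?F. x \<in> ?S"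
      by (simp add: eventually_at_filter)
    then have "\<forall>\<^sub>F x in ?F. 0 < fst x \<and> 0 < fst (snd x) \<and> lam * fst x / fst (snd x) \<le> 1 / 2
      \<and> fst (snd (snd x)) \<in> ?dom \<and> fst (snd (snd (snd x))) \<in> ?dom
      \<and> snd (snd (snd (snd x))) \<in> ?dom
      \<and> jx_step lam eps g (fst x) (fst (snd x)) (fst (snd (snd x)))
          (fst (snd (snd (snd x)))) (snd (snd (snd (snd x)))) \<in> ?dom"
      by (rule eventually_mono) auto
    from jx_dissipation_consistent[OF eps_pos lam_pos H_C1 conv g_cont
        jx_domain_fst[OF K_half_sum] lims that this]
    show ?thesis by (simp add: D_def case_prod_unfold)
  qed
  have flux: "hll_entropy_flux lam H Psi W W = Psi W" for W
    by (simp add: hll_entropy_flux_def)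
  show ?thesis
    using flux hll step consistent by (intro conjI exI[of _ D]) blast+
qed

end
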